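(* Let $D$ be a digraph with $d$ vertices and let $B\subset[d]\times[d]$ be the associated board. For integer partitions $\lambda,\mu$ let $\mathcal N^D_{\lambda,\mu}$ be the set of placements of $d$ non-taking rooks on $[d]\times[d]$ such that the type $(\pi,\sigma)$ of the path-cycle cover of $D$ formed by the set of edges corresponding to the rooks placed on $B$ satisfies $\mathrm{type}(\pi)=\lambda$ and $\mathrm{type}(\sigma)=\mu$, and let $N^D_{\lambda,\mu}=|\mathcal N^D_{\lambda,\mu}|$. Then $$\Xi_D=\sum_{\lambda,\mu}N^D_{\lambda,\mu}\,\tilde\Xi_{\lambda,\mu},$$ where the sum is over all integer partitions $\lambda$ and $\mu$.
   Context: A digraph is a finite labelled directed graph without multiple edges, possibly with loops and with bidirected edges. A digraph with $d$ vertices, taken to be $[d]=\{1,\dots,d\}$, is identified with its associated board $B=E(D)\subset[d]\times[d]$ (edge $(i,j)$ corresponds to the square in row $i$, column $j$). Rooks are non-taking if no two lie in the same row or in the same column. A path-cycle cover of $D$ is a subset $S$ of the edges of $D$ no two of which lie in the same row or column of the associated board; equivalently the spanning subgraph with edge set $S$ is a vertex-disjoint union of directed paths and directed cycles (isolated vertices are directed paths with no edges; loops are cycles of length one). $\pi(S)$ is the set of vertex sets of the directed paths, $\sigma(S)$ is the set of vertex sets of the directed cycles, and the type of $S$ is $(\pi(S),\sigma(S))$. The type of a collection of blocks is the integer partition of its block sizes; $\ell$ denotes the number of parts or blocks. $x$ and $y$ are two countably infinite sets of commuting independent indeterminates. For an integer partition $\lambda$ with $r_i$ parts equal to $i$,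 $\tilde m_\lambda=(r_1!\,r_2!\cdots)\,m_\lambda$, and $p_\lambda$ is the power sum symmetric function; a set partition as a subscript stands for its type. The path-cycle symmetric function is $\Xi_D=\Xi_D(x;y)=\sum_S\tilde m_{\pi(S)}(x)\,p_{\sigma(S)}(y)$, the sum over all path-cycle covers $S$ of $D$. For integer partitions $\lambda,\mu$, $D_{\lambda,\mu}$ is a disjoint union of directed paths and directed cycles such that the $i$th directed path has $\lambda_i$ vertices and the $j$th directed cycle has $\mu_j$ vertices, and $$\tilde\Xi_{\lambda,\mu}=\sum_S\frac{\tilde m_{\pi(S)}(x)\,p_{\sigma(S)}(y)}{\ell(\pi(S))!},$$ the sum over all path-cycle covers $S$ of $D_{\lambda,\mu}$. *)

theory Defs
  imports "HOL-Library.Poly_Mapping" "HOL-Library.Multiset" "Graph_Theory.Pair_Digraph"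
begin

section \<open>Formal power series in arbitrarily many commuting indeterminates\<close>

text \<open>
  A monomial over the indeterminates \<open>'v\<close> is its finitely supported exponent function, and a
  series is an arbitrary family of coefficients. Every monomial has only finitely many
  factorisations (lemma \<open>finite_mfactorisations\<close>), so that the convolution product is meaningful
  although \<open>'v\<close> may be infinite.
\<close>

typedef ('v, 'a) mseries = "UNIV :: (('v \<Rightarrow>\<^sub>0 nat) \<Rightarrow> 'a) set"
  morphisms mcoeff Abs_mseries ..

setup_lifting type_definition_mseries

lemma mseries_eqI: "(\<And>m. mcoeff f m = mcoeff g m) \<Longrightarrow> f = g"
  by transfer auto

definition mfactorisations :: "('v \<Rightarrow>\<^sub>0 nat) \<Rightarrow> (('v \<Rightarrow>\<^sub>0 nat) \<times> ('v \<Rightarrow>\<^sub>0 nat)) set" where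
  "mfactorisations m = {(a, b). a + b = m}"

lemma finite_mfactorisations [simp, intro]: "finite (mfactorisations m)"
proof -
  define N where "N = Max (insert 0 (Poly_Mapping.lookup m ` Poly_Mapping.keys m))"
  define F where "F = {f. \<forall>v. (v \<in> Poly_Mapping.keys m \<longrightarrow> f v \<in> {..N}) \<and>
                               (v \<notin> Poly_Mapping.keys m \<longrightarrow> f v = (0::nat))}"
  have finF: "finite F"
    unfolding F_def by (rule finite_set_of_finite_funs) auto
  have in_F: "Poly_Mapping.lookup c \<in> F" if le: "\<And>v. Poly_Mapping.lookup c v \<le> Poly_Mapping.lookup m v" for c
  proof -
    have "Poly_Mapping.lookup c v \<le> N" if "v \<in> Poly_Mapping.keys m" for v
    proof -
      have "Poly_Mapping.lookup m v \<le> N"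
        unfolding N_def using that by (intro Max_ge) auto
      with le[of v] show ?thesis
        by linarith
    qed
    moreover have "Poly_Mapping.lookup c v = 0" if "v \<notin> Poly_Mapping.keys m" for v
      using le[of v] that by (simp add: in_keys_iff)
    ultimately show ?thesis
      by (simp add: F_def)
  qed
  have "Poly_Mapping.lookup a \<in> F \<and> Poly_Mapping.lookup b \<in> F" if "a + b = m" for a b
    using that by (auto intro!: in_F simp: lookup_add)
  then have "(\<lambda>(a, b). (Poly_Mapping.lookup a, Poly_Mapping.lookup b)) ` mfactorisations m \<subseteq> F \<times> F"
    by (auto simp: mfactorisations_def)
  moreover have "inj_on (\<lambda>(a, b). (Poly_Mapping.lookup a, Poly_Mapping.lookup b)) (mfactorisations m)"
    by (auto simp: inj_on_def poly_mapping.lookup_inject)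
  moreover have "finite (F \<times> F)"
    using finF by simp
  ultimately show ?thesis
    by (meson inj_on_finite)
qed

instantiation mseries :: (type, comm_ring_1) comm_ring_1
begin

lift_definition zero_mseries :: "('a, 'b) mseries" is "\<lambda>_. 0" .
lift_definition one_mseries :: "('a, 'b) mseries" is "\<lambda>m. if m = 0 then 1 else 0" .
lift_definition plus_mseries :: "('a, 'b) mseries \<Rightarrow> ('a, 'b) mseries \<Rightarrow> ('a, 'b) mseries"
  is "\<lambda>f g m. f m + g m" .
lift_definition minus_mseries :: "('a, 'b) mseries \<Rightarrow> ('a, 'b) mseries \<Rightarrow> ('a, 'b) mseries"
  is "\<lambda>f g m. f m - g m" .
lift_definition uminus_mseries :: "('a, 'b) mseries \<Rightarrow> ('a, 'b) mseries"
  is "\<lambda>f m. - f m" .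
lift_definition times_mseries :: "('a, 'b) mseries \<Rightarrow> ('a, 'b) mseries \<Rightarrow> ('a, 'b) mseries"
  is "\<lambda>f g m. \<Sum>(a, b) \<in> mfactorisations m. f a * g b" .

instance
proof
  fix f g h :: "('a, 'b) mseries"
  show "f * g * h = f * (g * h)"
  proof (transfer, rule ext)
    fix f g h :: "('a \<Rightarrow>\<^sub>0 nat) \<Rightarrow> 'b" and m
    let ?F = "mfactorisations :: ('a \<Rightarrow>\<^sub>0 nat) \<Rightarrow> _"
    have "(\<Sum>(a, b)\<in>?F m. (\<Sum>(c, e)\<in>?F a. f c * g e) * h b) =
          (\<Sum>p\<in>?F m. \<Sum>q\<in>?F (fst p). f (fst q) * g (snd q) * h (snd p))"
      by (simp add: case_prod_beta sum_distrib_right)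
    also have "\<dots> = (\<Sum>(p, q)\<in>Sigma (?F m) (\<lambda>p. ?F (fst p)).
                      f (fst q) * g (snd q) * h (snd p))"
      by (subst sum.Sigma) (auto)
    also have "\<dots> = (\<Sum>(p, q)\<in>Sigma (?F m) (\<lambda>p. ?F (snd p)).
                      f (fst p) * (g (fst q) * h (snd q)))"
      by (rule sum.reindex_bij_witness
            [where i = "\<lambda>(p, q). ((fst p + fst q, snd q), (fst p, fst q))"
               and j = "\<lambda>(p, q). ((fst q, snd q + snd p), (snd q, snd p))"])
         (auto simp: mfactorisations_def add.assoc mult.assoc)
    also have "\<dots> = (\<Sum>p\<in>?F m. \<Sum>q\<in>?F (snd p). f (fst p) * (g (fst q) * h (snd q)))"
      by (subst sum.Sigma) (auto)
    also have "\<dots> = (\<Sum>(a, b)\<in>?F m. f a * (\<Sum>(c, e)\<in>?F b. g c * h e))"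
      by (simp add: case_prod_beta sum_distrib_left)
    finally show "(\<Sum>(a, b)\<in>?F m. (\<Sum>(c, e)\<in>?F a. f c * g e) * h b) =
                  (\<Sum>(a, b)\<in>?F m. f a * (\<Sum>(c, e)\<in>?F b. g c * h e))" .
  qed
  show "f * g = g * f"
  proof (transfer, rule ext)
    fix f g :: "('a \<Rightarrow>\<^sub>0 nat) \<Rightarrow> 'b" and m
    show "(\<Sum>(a, b)\<in>mfactorisations m. f a * g b) = (\<Sum>(a, b)\<in>mfactorisations m. g a * f b)"
      by (rule sum.reindex_bij_witness[where i = prod.swap and j = prod.swap])
         (auto simp: mfactorisations_def add.commute mult.commute)
  qed
  show "1 * f = f"
  proof (transfer, rule ext)
    fix f :: "('a \<Rightarrow>\<^sub>0 nat) \<Rightarrow> 'b" and m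
    have "(\<Sum>(a, b)\<in>mfactorisations m. (if a = 0 then 1 else 0) * f b) =
          (\<Sum>(a, b)\<in>{(0 :: 'a \<Rightarrow>\<^sub>0 nat, m)}. (if a = 0 then 1 else 0) * f b)"
      by (rule sum.mono_neutral_right[OF finite_mfactorisations])
         (auto simp: mfactorisations_def split: if_splits)
    then show "(\<Sum>(a, b)\<in>mfactorisations m. (if a = 0 then 1 else 0) * f b) = f m"
      by simp
  qed
  show "(f + g) * h = f * h + g * h"
    by transfer (simp add: case_prod_beta distrib_right sum.distrib)
  show "(0 :: ('a, 'b) mseries) \<noteq> 1"
    by transfer (auto simp: fun_eq_iff)
qed (transfer; auto simp: algebra_simps)+

end

lift_definition mconst :: "'a::zero \<Rightarrow> ('v, 'a) mseries" is
  "\<lambda>c m. if m = 0 then c else 0" .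


section \<open>Integer partitions and symmetric functions\<close>

text \<open>An integer partition is the multiset of its (positive) parts.\<close>

definition integer_partition :: "nat multiset \<Rightarrow> bool" where
  "integer_partition lam \<longleftrightarrow> 0 \<notin># lam"

definition parts_list :: "nat multiset \<Rightarrow> nat list" where
  "parts_list lam = rev (sorted_list_of_multiset lam)"

text \<open>
  An alphabet of countably many indeterminates is an injection \<open>v :: nat \<Rightarrow> 'v\<close> into the
  indeterminates of the ambient series ring.
\<close>

lift_definition monomial_sym :: "(nat \<Rightarrow> 'v) \<Rightarrow> nat multiset \<Rightarrow> ('v, 'a::zero_neq_one) mseries" is
  "\<lambda>v lam m. if Poly_Mapping.keys m \<subseteq> range v \<and>
     image_mset (Poly_Mapping.lookup m) (mset_set (Poly_Mapping.keys m)) = lam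
   then 1 else 0" .

definition aug_monomial_sym ::
    "(nat \<Rightarrow> 'v) \<Rightarrow> nat multiset \<Rightarrow> ('v, 'a::comm_ring_1) mseries" where
  "aug_monomial_sym v lam = of_nat (\<Prod>i\<in>set_mset lam. fact (count lam i)) * monomial_sym v lam"

text \<open>The series \<open>\<Sum>\<^sub>i (v i)\<^sup>n\<close>, for \<open>n > 0\<close>.\<close>

lift_definition power_sum1 :: "(nat \<Rightarrow> 'v) \<Rightarrow> nat \<Rightarrow> ('v, 'a::zero_neq_one) mseries" is
  "\<lambda>v n m. if \<exists>i. m = Poly_Mapping.single (v i) n then 1 else 0" .

definition power_sum :: "(nat \<Rightarrow> 'v) \<Rightarrow> nat multiset \<Rightarrow> ('v, 'a::comm_ring_1) mseries" where
  "power_sum v mu = (\<Prod>n\<in>#mu. power_sum1 v n)"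

text \<open>Series in the two alphabets \<open>x\<^sub>i = Inl i\<close> and \<open>y\<^sub>i = Inr i\<close>.\<close>

type_synonym xy_series = "(nat + nat, rat) mseries"

abbreviation aug_monomial_x :: "nat multiset \<Rightarrow> xy_series" where
  "aug_monomial_x \<equiv> aug_monomial_sym Inl"

abbreviation power_sum_y :: "nat multiset \<Rightarrow> xy_series" where
  "power_sum_y \<equiv> power_sum Inr"


section \<open>Path-cycle covers\<close>

definition non_taking :: "('a \<times> 'a) set \<Rightarrow> bool" where
  "non_taking R \<longleftrightarrow> (\<forall>r\<in>R. \<forall>s\<in>R. r \<noteq> s \<longrightarrow> fst r \<noteq> fst s \<and> snd r \<noteq> snd s)"

definition path_cycle_covers :: "'a pair_pre_digraph \<Rightarrow> ('a \<times> 'a) set set" where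
  "path_cycle_covers D = {S. S \<subseteq> parcs D \<and> non_taking S}"

definition dipath_arcs :: "'a list \<Rightarrow> ('a \<times> 'a) set" where
  "dipath_arcs vs = set (zip vs (tl vs))"

definition dicycle_arcs :: "'a list \<Rightarrow> ('a \<times> 'a) set" where
  "dicycle_arcs vs = set (zip vs (rotate1 vs))"

definition incident_arcs :: "('a \<times> 'a) set \<Rightarrow> 'a set \<Rightarrow> ('a \<times> 'a) set" where
  "incident_arcs S W = {e \<in> S. fst e \<in> W \<or> snd e \<in> W}"

text \<open>
  The vertex sets of those components of the spanning subgraph with arc set \<open>S\<close> that are
  directed paths, respectively directed cycles: using all arcs of \<open>S\<close> incident with the vertices
  in \<open>vs\<close> forces these vertices to form an entire component. A single vertex \<open>[v]\<close> gives a path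
  without arcs and a cycle consisting of a loop.
\<close>

definition path_blocks :: "'a pair_pre_digraph \<Rightarrow> ('a \<times> 'a) set \<Rightarrow> 'a set set" where
  "path_blocks D S = {set vs | vs. vs \<noteq> [] \<and> distinct vs \<and> set vs \<subseteq> pverts D \<and>
                                   incident_arcs S (set vs) = dipath_arcs vs}"

definition cycle_blocks :: "'a pair_pre_digraph \<Rightarrow> ('a \<times> 'a) set \<Rightarrow> 'a set set" where
  "cycle_blocks D S = {set vs | vs. vs \<noteq> [] \<and> distinct vs \<and> set vs \<subseteq> pverts D \<and>
                                    incident_arcs S (set vs) = dicycle_arcs vs}"

definition block_type :: "'a set set \<Rightarrow> nat multiset" where
  "block_type P = image_mset card (mset_set P)"

definition path_cycle_sym :: "'a pair_pre_digraph \<Rightarrow> xy_series" where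
  "path_cycle_sym D = (\<Sum>S\<in>path_cycle_covers D.
     aug_monomial_x (block_type (path_blocks D S)) * power_sum_y (block_type (cycle_blocks D S)))"

text \<open>
  The digraph \<open>D\<^bsub>\<lambda>,\<mu>\<^esub>\<close>: the \<open>k\<close>-th vertex of the \<open>i\<close>-th path is \<open>Inl (i, k)\<close>, that of the
  \<open>i\<close>-th cycle is \<open>Inr (i, k)\<close>, all indices starting from 0.
\<close>

definition path_cycle_digraph ::
    "nat multiset \<Rightarrow> nat multiset \<Rightarrow> (nat \<times> nat + nat \<times> nat) pair_pre_digraph" where
  "path_cycle_digraph lam mu = (let ls = parts_list lam; ms = parts_list mu in
     \<lparr> pverts = {Inl (i, k) | i k. i < length ls \<and> k < ls ! i} \<union>
                {Inr (i, k) | i k. i < length ms \<and> k < ms ! i},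
       parcs = {(Inl (i, k), Inl (i, k + 1)) | i k. i < length ls \<and> k + 1 < ls ! i} \<union>
               {(Inr (i, k), Inr (i, (k + 1) mod (ms ! i))) | i k. i < length ms \<and> k < ms ! i} \<rparr>)"

definition path_cycle_sym_tilde :: "nat multiset \<Rightarrow> nat multiset \<Rightarrow> xy_series" where
  "path_cycle_sym_tilde lam mu = (let D = path_cycle_digraph lam mu in
     \<Sum>S\<in>path_cycle_covers D. mconst (1 / fact (card (path_blocks D S))) *
       (aug_monomial_x (block_type (path_blocks D S)) *
        power_sum_y (block_type (cycle_blocks D S))))"


section \<open>Rook placements\<close>

definition rook_placements ::
    "nat \<Rightarrow> nat pair_pre_digraph \<Rightarrow> nat multiset \<Rightarrow> nat multiset \<Rightarrow> (nat \<times> nat) set set" where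
  "rook_placements d D lam mu = {R. R \<subseteq> {1..d} \<times> {1..d} \<and> non_taking R \<and> card R = d \<and>
     block_type (path_blocks D (R \<inter> parcs D)) = lam \<and>
     block_type (cycle_blocks D (R \<inter> parcs D)) = mu}"

definition rook_number ::
    "nat \<Rightarrow> nat pair_pre_digraph \<Rightarrow> nat multiset \<Rightarrow> nat multiset \<Rightarrow> nat" where
  "rook_number d D lam mu = card (rook_placements d D lam mu)"

text \<open>
  A sum over all pairs of partitions with coefficients \<open>rook_number d D lam mu\<close> has only
  finitely many nonzero terms, so that it may be written as a sum over the following set.
\<close>

lemma finite_rook_support:
  "finite {(lam, mu). integer_partition lam \<and> integer_partition mu \<and> rook_number d D lam mu \<noteq> 0}"
  (is "finite ?A")
proof (rule finite_subset)
  let ?t = "\<lambda>R. (block_type (path_blocks D (R \<inter> parcs D)),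
                 block_type (cycle_blocks D (R \<inter> parcs D)))"
  show "?A \<subseteq> ?t ` Pow ({1..d} \<times> {1..d})"
  proof (rule subrelI)
    fix lam mu assume "(lam, mu) \<in> ?A"
    then have "rook_placements d D lam mu \<noteq> {}"
      by (auto simp: rook_number_def)
    then show "(lam, mu) \<in> ?t ` Pow ({1..d} \<times> {1..d})"
      by (auto simp: rook_placements_def)
  qed
qed simp

end

theory Submission
  imports Defs
begin

text \<open>
  The identity is a double count of the pairs \<open>(S, R)\<close> in which \<open>R\<close> places \<open>d\<close> non-taking rooks on
  the square board, \<open>S\<close> is a path-cycle cover of \<open>D\<close>, and \<open>S \<subseteq> R\<close>. Such a pair gets the weight
  of \<open>S\<close>, that is its term in the path-cycle symmetric function, divided by \<open>l!\<close>, where \<open>l\<close> is the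
  number of directed paths of \<open>S\<close>.

  For fixed \<open>S\<close>, each path has one arc fewer than vertices and each cycle has equally many, so that
  \<open>l = d - card S\<close> (\<open>card_path_blocks\<close>). On the other hand, \<open>card S\<close> non-taking rooks extend to \<open>d\<close>
  non-taking rooks in \<open>(d - card S)!\<close> ways (\<open>card_rook_completions\<close>). Hence the denominator cancels
  the number of choices for \<open>R\<close>, and summing over \<open>S\<close> gives the path-cycle symmetric function.

  For fixed \<open>R\<close>, the covers \<open>S \<subseteq> R\<close> of \<open>D\<close> are exactly the subsets of the cover \<open>C = R \<inter> parcs D\<close>.
  As \<open>C\<close> is a disjoint union of paths and cycles, the digraph with arc set \<open>C\<close> is isomorphic to the
  standard digraph whose path and cycle lengths are given by the type of \<open>C\<close>
  (\<open>cover_isomorphic_path_cycle_digraph\<close>); the weights are invariant under isomorphism, so the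
  inner sum is the series \<open>path_cycle_sym_tilde\<close> of that type (\<open>path_cycle_sym_tilde_cover\<close>).
  Collecting the placements \<open>R\<close> by the type of \<open>C\<close> produces the rook numbers as coefficients.

  What makes this precise is that the path blocks and cycle blocks of a cover partition the
  vertices: each vertex lies in some block (\<open>ex_block\<close>) and in only one (\<open>blocks_eqI\<close>), and no block
  is of both kinds (\<open>path_blocks_disjoint_cycle_blocks\<close>).
\<close>

section \<open>Components of a path-cycle cover\<close>

lemma non_taking_iff_inj_on: "non_taking R \<longleftrightarrow> inj_on fst R \<and> inj_on snd R"
  by (auto simp: non_taking_def inj_on_def)

lemma non_taking_mono: "non_taking R \<Longrightarrow> S \<subseteq> R \<Longrightarrow> non_taking S"
  unfolding non_taking_def by blast

lemma dipath_arcs_nth: "dipath_arcs vs = {(vs ! k, vs ! (k + 1)) | k. k + 1 < length vs}"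
  by (auto simp: dipath_arcs_def set_zip nth_tl)

lemma dicycle_arcs_nth: "dicycle_arcs vs = {(vs ! k, vs ! ((k + 1) mod length vs)) | k. k < length vs}"
  unfolding dicycle_arcs_def set_zip by (auto simp: nth_rotate1)

lemma dipath_arcs_subset_dicycle_arcs: "dipath_arcs vs \<subseteq> dicycle_arcs vs"
  unfolding dipath_arcs_nth dicycle_arcs_nth by force

lemma dicycle_arcs_subset: "dicycle_arcs vs \<subseteq> set vs \<times> set vs"
  unfolding dicycle_arcs_def by (auto dest: set_zip_leftD set_zip_rightD)

lemma dicycle_arcs_eq_insert:
  assumes "vs \<noteq> []"
  shows "dicycle_arcs vs = insert (last vs, hd vs) (dipath_arcs vs)"
proof
  show "dicycle_arcs vs \<subseteq> insert (last vs, hd vs) (dipath_arcs vs)"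
  proof
    fix e assume "e \<in> dicycle_arcs vs"
    then obtain k where k: "k < length vs" "e = (vs ! k, vs ! ((k + 1) mod length vs))"
      by (auto simp: dicycle_arcs_nth)
    show "e \<in> insert (last vs, hd vs) (dipath_arcs vs)"
    proof (cases "k + 1 < length vs")
      case True
      with k show ?thesis by (auto simp: dipath_arcs_nth)
    next
      case False
      with k have "k = length vs - 1" "k + 1 = length vs" by auto
      with k assms show ?thesis by (simp add: last_conv_nth hd_conv_nth)
    qed
  qed
  have "(last vs, hd vs) \<in> dicycle_arcs vs"
    unfolding dicycle_arcs_nth using assms
    by (auto simp: last_conv_nth hd_conv_nth intro!: exI[of _ "length vs - 1"])
  then show "insert (last vs, hd vs) (dipath_arcs vs) \<subseteq> dicycle_arcs vs"
    using dipath_arcs_subset_dicycle_arcs by auto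
qed

lemma card_dipath_arcs: "distinct vs \<Longrightarrow> card (dipath_arcs vs) = length vs - 1"
  unfolding dipath_arcs_def by (subst distinct_card) (auto intro: distinct_zipI1)

lemma card_dicycle_arcs: "distinct vs \<Longrightarrow> card (dicycle_arcs vs) = length vs"
  unfolding dicycle_arcs_def by (subst distinct_card) (auto intro: distinct_zipI1)

text \<open>
  Membership in a set closed under adjacency propagates along a path. Applied to two blocks that
  share a vertex, in both directions, this shows that they coincide.
\<close>

lemma dipath_arcs_connected:
  assumes "dipath_arcs vs \<subseteq> S" and "\<forall>(a, b)\<in>S. a \<in> W \<longleftrightarrow> b \<in> W"
    and "x \<in> set vs" and "x \<in> W"
  shows "set vs \<subseteq> W"
proof -
  have step: "vs ! k \<in> W \<longleftrightarrow> vs ! Suc k \<in> W" if "Suc k < length vs" for k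
    using assms(1,2) that by (fastforce simp: dipath_arcs_nth)
  have eq: "vs ! k \<in> W \<longleftrightarrow> vs ! 0 \<in> W" if "k < length vs" for k
    using that by (induction k) (auto simp: step)
  obtain j where "j < length vs" "x = vs ! j"
    using assms(3) by (auto simp: in_set_conv_nth)
  with eq assms(4) show ?thesis
    by (auto simp: in_set_conv_nth)
qed

lemma block_props:
  assumes "W \<in> path_blocks D S \<union> cycle_blocks D S"
  shows block_closed: "\<forall>(a, b)\<in>S. a \<in> W \<longleftrightarrow> b \<in> W"
    and block_list: "\<exists>vs. vs \<noteq> [] \<and> W = set vs \<and> dipath_arcs vs \<subseteq> S"
    and block_subset: "W \<subseteq> pverts D"
proof -
  obtain vs where vs: "W = set vs" "vs \<noteq> []" "W \<subseteq> pverts D"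
     "incident_arcs S (set vs) = dipath_arcs vs \<or> incident_arcs S (set vs) = dicycle_arcs vs"
    using assms by (auto simp: path_blocks_def cycle_blocks_def)
  have sub: "dipath_arcs vs \<subseteq> incident_arcs S W" "incident_arcs S W \<subseteq> W \<times> W"
    using vs dipath_arcs_subset_dicycle_arcs[of vs] dicycle_arcs_subset[of vs] by auto
  from sub(1) vs show "\<exists>vs. vs \<noteq> [] \<and> W = set vs \<and> dipath_arcs vs \<subseteq> S"
    by (auto simp: incident_arcs_def)
  from sub(2) show "\<forall>(a, b)\<in>S. a \<in> W \<longleftrightarrow> b \<in> W"
    by (auto simp: incident_arcs_def)
  show "W \<subseteq> pverts D" by fact
qed

lemma block_nonempty: "W \<in> path_blocks D S \<union> cycle_blocks D S \<Longrightarrow> W \<noteq> {}"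
  using block_list by fastforce

lemma blocks_eqI:
  assumes "W \<in> path_blocks D S \<union> cycle_blocks D S" "W' \<in> path_blocks D S \<union> cycle_blocks D S"
    and "x \<in> W" "x \<in> W'"
  shows "W = W'"
  using dipath_arcs_connected block_list[OF assms(1)] block_closed[OF assms(1)]
    block_list[OF assms(2)] block_closed[OF assms(2)] assms(3,4)
  by (metis subset_antisym)

text \<open>The number of arcs at a block tells the two kinds apart.\<close>

lemma path_blocks_disjoint_cycle_blocks: "path_blocks D S \<inter> cycle_blocks D S = {}"
proof -
  have False if "vs \<noteq> []" "distinct vs" "distinct us" "set vs = set us"
    "dipath_arcs vs = dicycle_arcs us" for vs us :: "'a list"
  proof -
    have "length vs = length us"
      using that by (metis distinct_card)
    moreover have "length vs - 1 = length us"
      using that card_dipath_arcs card_dicycle_arcs by metis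
    ultimately show False using that(1) by (cases vs) auto
  qed
  then show ?thesis
    unfolding path_blocks_def cycle_blocks_def by (smt (verit) disjoint_iff mem_Collect_eq)
qed

lemma finite_blocks:
  assumes "finite (pverts D)"
  shows "finite (path_blocks D S)" "finite (cycle_blocks D S)"
  using assms block_subset[of _ D S] by (auto intro!: finite_subset[of _ "Pow (pverts D)"])

text \<open>
  Take a longest directed path in \<open>S\<close> through the given vertex. By maximality no arc leads
  from its last vertex to a vertex outside it, or from such a vertex to its first. Since every vertex
  has at most one arc in and one arc out, the only further arc of \<open>S\<close> that can touch it leads from
  its last vertex to its first. The path is a
  path block or a cycle block according to whether that arc is absent or present.
\<close>

lemma ex_block:
  assumes fin: "finite (pverts D)" and S: "S \<subseteq> pverts D \<times> pverts D" "non_taking S"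
    and v: "v \<in> pverts D"
  shows "\<exists>W\<in>path_blocks D S \<union> cycle_blocks D S. v \<in> W"
proof -
  define P where "P vs \<longleftrightarrow> v \<in> set vs \<and> distinct vs \<and> set vs \<subseteq> pverts D \<and> dipath_arcs vs \<subseteq> S" for vs
  have "P [v]" using v by (auto simp: P_def dipath_arcs_def)
  moreover have "length vs < card (pverts D) + 1" if "P vs" for vs
    using that card_mono[OF fin, of "set vs"] by (auto simp: P_def distinct_card)
  ultimately obtain vs where vs: "P vs" and max: "\<And>us. P us \<Longrightarrow> length us \<le> length vs"
    using ex_has_greatest_nat[of P "[v]" length] by (metis less_imp_le)
  have ne: "vs \<noteq> []" and dist: "distinct vs" and V: "set vs \<subseteq> pverts D"
    and arcs: "dipath_arcs vs \<subseteq> S" and v: "v \<in> set vs"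
    using vs by (auto simp: P_def)
  have fsts: "b = b'" if "(a, b) \<in> S" "(a, b') \<in> S" for a b b'
    using S(2) that by (force simp: non_taking_def)
  have snds: "a = a'" if "(a, b) \<in> S" "(a', b) \<in> S" for a a' b
    using S(2) that by (force simp: non_taking_def)
  have arc: "(vs ! k, vs ! Suc k) \<in> S" if "Suc k < length vs" for k
    using arcs that by (auto simp: dipath_arcs_nth)
  \<comment> \<open>An arc out of the last vertex ends on the path by maximality, and only at its first vertex,
    because the others already have an incoming arc.\<close>
  have out: "b = hd vs" if "(last vs, b) \<in> S" for b
  proof -
    have "b \<in> set vs"
    proof (rule ccontr)
      assume "b \<notin> set vs"
      moreover have "dipath_arcs (vs @ [b]) \<subseteq> S"
      proof -
        have "dipath_arcs (vs @ [b]) \<subseteq> insert (last vs, b) (dipath_arcs vs)"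
        proof
          fix e assume "e \<in> dipath_arcs (vs @ [b])"
          then obtain k where k: "k < length vs" "e = ((vs @ [b]) ! k, (vs @ [b]) ! (k + 1))"
            by (auto simp: dipath_arcs_nth)
          show "e \<in> insert (last vs, b) (dipath_arcs vs)"
          proof (cases "k + 1 < length vs")
            case True
            with k show ?thesis by (auto simp: dipath_arcs_nth nth_append)
          next
            case False
            with k have "k = length vs - 1" by auto
            with k ne show ?thesis by (auto simp: nth_append last_conv_nth)
          qed
        qed
        with that arcs show ?thesis by auto
      qed
      ultimately have "P (vs @ [b])"
        using vs that S(1) by (auto simp: P_def)
      from max[OF this] show False by simp
    qed
    then obtain j where j: "j < length vs" "b = vs ! j" by (auto simp: in_set_conv_nth)
    show ?thesis
    proof (cases j)
      case 0
      with j ne show ?thesis by (simp add: hd_conv_nth)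
    next
      case (Suc i)
      then have "vs ! i = last vs" using arc[of i] j snds that by auto
      then have "i = length vs - 1"
        using dist ne j Suc by (simp add: last_conv_nth nth_eq_iff_index_eq)
      with j Suc show ?thesis by simp
    qed
  qed
  have into: "a = last vs" if "(a, hd vs) \<in> S" for a
  proof -
    have "a \<in> set vs"
    proof (rule ccontr)
      assume "a \<notin> set vs"
      moreover have "dipath_arcs (a # vs) = insert (a, hd vs) (dipath_arcs vs)"
        using ne by (cases vs) (auto simp: dipath_arcs_def)
      ultimately have "P (a # vs)"
        using vs that S(1) by (auto simp: P_def)
      from max[OF this] show False by simp
    qed
    then obtain j where j: "j < length vs" "a = vs ! j" by (auto simp: in_set_conv_nth)
    show ?thesis
    proof (cases "Suc j < length vs")
      case True
      then have "vs ! Suc j = vs ! 0" using arc[of j] j fsts that ne by (auto simp: hd_conv_nth)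
      with True dist ne show ?thesis by (simp add: nth_eq_iff_index_eq)
    next
      case False
      with j have "j = length vs - 1" by simp
      with j ne show ?thesis by (simp add: last_conv_nth)
    qed
  qed
  have inc: "incident_arcs S (set vs) \<subseteq> insert (last vs, hd vs) (dipath_arcs vs)"
  proof
    fix e assume e: "e \<in> incident_arcs S (set vs)"
    obtain a b where ab: "e = (a, b)" by force
    have eS: "(a, b) \<in> S" and "a \<in> set vs \<or> b \<in> set vs" using e ab by (auto simp: incident_arcs_def)
    from this(2) show "e \<in> insert (last vs, hd vs) (dipath_arcs vs)"
    proof
      assume "a \<in> set vs"
      then obtain j where j: "j < length vs" "a = vs ! j" by (auto simp: in_set_conv_nth)
      show ?thesis
      proof (cases "Suc j < length vs")
        case True
        with arc[OF True] fsts eS j ab show ?thesis by (auto simp: dipath_arcs_nth)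
      next
        case False
        with j have "j = length vs - 1" by simp
        with j ne have "a = last vs" by (simp add: last_conv_nth)
        with out eS ab show ?thesis by auto
      qed
    next
      assume "b \<in> set vs"
      then obtain j where j: "j < length vs" "b = vs ! j" by (auto simp: in_set_conv_nth)
      show ?thesis
      proof (cases j)
        case 0
        with j ne have "b = hd vs" by (simp add: hd_conv_nth)
        with into eS ab show ?thesis by auto
      next
        case (Suc i)
        with j arc[of i] snds eS ab show ?thesis by (auto simp: dipath_arcs_nth)
      qed
    qed
  qed
  have arcs': "dipath_arcs vs \<subseteq> incident_arcs S (set vs)"
    using arcs dipath_arcs_subset_dicycle_arcs[of vs] dicycle_arcs_subset[of vs]
    by (auto simp: incident_arcs_def)
  show ?thesis
  proof (cases "(last vs, hd vs) \<in> S")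
    case True
    then have "incident_arcs S (set vs) = dicycle_arcs vs"
      using inc arcs' ne by (auto simp: dicycle_arcs_eq_insert incident_arcs_def)
    then have "set vs \<in> cycle_blocks D S"
      using ne dist V by (auto simp: cycle_blocks_def)
    with v show ?thesis by blast
  next
    case False
    then have "incident_arcs S (set vs) = dipath_arcs vs"
      using inc arcs' by (auto simp: incident_arcs_def)
    then have "set vs \<in> path_blocks D S"
      using ne dist V by (auto simp: path_blocks_def)
    with v show ?thesis by blast
  qed
qed

lemma Union_blocks:
  assumes "finite (pverts D)" "S \<subseteq> pverts D \<times> pverts D" "non_taking S"
  shows "\<Union>(path_blocks D S \<union> cycle_blocks D S) = pverts D"
  using ex_block[OF assms] block_subset[of _ D S] by blast

lemma Union_incident_arcs:
  assumes "finite (pverts D)" "S \<subseteq> pverts D \<times> pverts D" "non_taking S"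
  shows "(\<Union>W\<in>path_blocks D S \<union> cycle_blocks D S. incident_arcs S W) = S"
proof
  show "S \<subseteq> (\<Union>W\<in>path_blocks D S \<union> cycle_blocks D S. incident_arcs S W)"
  proof
    fix e assume e: "e \<in> S"
    then have "fst e \<in> pverts D" using assms(2) by auto
    from ex_block[OF assms this] e
    show "e \<in> (\<Union>W\<in>path_blocks D S \<union> cycle_blocks D S. incident_arcs S W)"
      by (auto simp: incident_arcs_def)
  qed
qed (auto simp: incident_arcs_def)

text \<open>
  Sum over the blocks: a path has one arc fewer than vertices, a cycle has as many arcs as
  vertices, and the blocks partition both the vertices and the arcs.
\<close>

lemma card_path_blocks:
  assumes fin: "finite (pverts D)" and S: "S \<subseteq> pverts D \<times> pverts D" "non_taking S"
  shows "card (path_blocks D S) + card S = card (pverts D)"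
proof -
  let ?P = "path_blocks D S" and ?C = "cycle_blocks D S"
  note fb = finite_blocks[OF fin, of S]
  have finS: "finite S" using S(1) fin by (meson finite_SigmaI finite_subset)
  have "card S = card (\<Union>W\<in>?P \<union> ?C. incident_arcs S W)"
    by (simp only: Union_incident_arcs[OF assms])
  also have "\<dots> = (\<Sum>W\<in>?P \<union> ?C. card (incident_arcs S W))"
  proof (rule card_UN_disjoint)
    show "\<forall>W\<in>?P \<union> ?C. finite (incident_arcs S W)"
      using finS by (auto simp: incident_arcs_def)
    show "\<forall>W\<in>?P \<union> ?C. \<forall>W'\<in>?P \<union> ?C. W \<noteq> W' \<longrightarrow> incident_arcs S W \<inter> incident_arcs S W' = {}"
    proof (intro ballI impI, rule ccontr)
      fix W W' assume W: "W \<in> ?P \<union> ?C" and W': "W' \<in> ?P \<union> ?C" and "W \<noteq> W'"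
        and "incident_arcs S W \<inter> incident_arcs S W' \<noteq> {}"
      then obtain e where "e \<in> incident_arcs S W" "e \<in> incident_arcs S W'" by blast
      then obtain a b where "(a, b) \<in> S" "a \<in> W \<or> b \<in> W" "a \<in> W' \<or> b \<in> W'"
        by (cases e) (auto simp: incident_arcs_def)
      then have "a \<in> W" "a \<in> W'"
        using block_closed[OF W] block_closed[OF W'] by auto
      from blocks_eqI[OF W W' this] \<open>W \<noteq> W'\<close> show False by simp
    qed
  qed (use fb in auto)
  also have "\<dots> = (\<Sum>W\<in>?P. card (incident_arcs S W)) + (\<Sum>W\<in>?C. card (incident_arcs S W))"
    using fb path_blocks_disjoint_cycle_blocks by (intro sum.union_disjoint) auto
  finally have "card ?P + card S =
      (\<Sum>W\<in>?P. 1 + card (incident_arcs S W)) + (\<Sum>W\<in>?C. card (incident_arcs S W))"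
    by (simp only: sum.distrib) simp
  also have "(\<Sum>W\<in>?P. 1 + card (incident_arcs S W)) = (\<Sum>W\<in>?P. card W)"
  proof (rule sum.cong)
    fix W assume "W \<in> ?P"
    then obtain vs where "W = set vs" "vs \<noteq> []" "distinct vs" "incident_arcs S W = dipath_arcs vs"
      by (auto simp: path_blocks_def)
    then show "1 + card (incident_arcs S W) = card W"
      by (cases vs) (simp_all add: card_dipath_arcs distinct_card)
  qed simp
  also have "(\<Sum>W\<in>?C. card (incident_arcs S W)) = (\<Sum>W\<in>?C. card W)"
  proof (rule sum.cong)
    fix W assume "W \<in> ?C"
    then obtain vs where "W = set vs" "distinct vs" "incident_arcs S W = dicycle_arcs vs"
      by (auto simp: cycle_blocks_def)
    then show "card (incident_arcs S W) = card W"
      by (simp add: card_dicycle_arcs distinct_card)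
  qed simp
  also have "(\<Sum>W\<in>?P. card W) + (\<Sum>W\<in>?C. card W) = (\<Sum>W\<in>?P \<union> ?C. card W)"
    using fb path_blocks_disjoint_cycle_blocks by (intro sum.union_disjoint[symmetric]) auto
  also have "\<dots> = card (\<Union>(?P \<union> ?C))"
  proof (rule card_Union_disjoint[symmetric])
    show "disjoint (?P \<union> ?C)"
    proof (rule disjointI)
      fix W W' assume W: "W \<in> ?P \<union> ?C" and W': "W' \<in> ?P \<union> ?C" and "W \<noteq> W'"
      then show "W \<inter> W' = {}" using blocks_eqI[OF W W'] by blast
    qed
    show "finite W" if "W \<in> ?P \<union> ?C" for W
      using block_subset[OF that] fin by (rule finite_subset)
  qed
  finally show ?thesis by (simp only: Union_blocks[OF assms])
qed


section \<open>Completions of a rook placement\<close>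

text \<open>
  Choose a row without a rook. A completion has a rook in this row, and its column is one of the
  \<open>d - card S\<close> free ones. Adding this rook to \<open>S\<close> reduces to a placement with one rook more.
\<close>

lemma card_rook_completions:
  assumes "finite A" "finite B" "card A = d" "card B = d" "S \<subseteq> A \<times> B" "non_taking S"
  shows "card {R. R \<subseteq> A \<times> B \<and> non_taking R \<and> card R = d \<and> S \<subseteq> R} = fact (d - card S)"
  using assms(5,6)
proof (induction "d - card S" arbitrary: S)
  case 0
  have finAB: "finite (A \<times> B)" using assms by simp
  \<comment> \<open>That the truncated difference is zero means \<open>d \<le> card S\<close>; equality holds as there are only \<open>d\<close> rows.\<close>
  have "card S = card (fst ` S)"
    using 0 by (simp add: non_taking_iff_inj_on card_image)
  also have "\<dots> \<le> d" using card_mono[OF assms(1), of "fst ` S"] 0 assms(3) by fastforce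
  finally have "card S = d" using 0 by simp
  moreover have "R = S" if "R \<subseteq> A \<times> B" "card R = card S" "S \<subseteq> R" for R
    using that card_subset_eq[of R S] finite_subset[OF _ finAB, of R] by simp
  ultimately have "{R. R \<subseteq> A \<times> B \<and> non_taking R \<and> card R = d \<and> S \<subseteq> R} = {S}"
    using 0 by auto
  then show ?case using 0 by simp
next
  case (Suc n)
  let ?X = "\<lambda>S. {R. R \<subseteq> A \<times> B \<and> non_taking R \<and> card R = d \<and> S \<subseteq> R}"
  have finAB: "finite (A \<times> B)" using assms by simp
  have finX: "finite (?X T)" for T
    using finAB by (auto intro: finite_subset[of _ "Pow (A \<times> B)"])
  have finS: "finite S" using Suc.prems(1) finAB finite_subset by blast
  have c1: "card (fst ` S) = card S" and c2: "card (snd ` S) = card S"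
    using Suc.prems by (auto simp: non_taking_iff_inj_on card_image)
  have sub: "fst ` S \<subseteq> A" "snd ` S \<subseteq> B" using Suc.prems(1) by auto
  have "card (A - fst ` S) = Suc n"
    using sub c1 assms Suc.hyps(2) finS by (simp add: card_Diff_subset)
  then have "A - fst ` S \<noteq> {}" by force
  then obtain a where a: "a \<in> A" "a \<notin> fst ` S" by blast
  have cB: "card (B - snd ` S) = Suc n"
    using sub c2 assms Suc.hyps(2) finS by (simp add: card_Diff_subset)
  have row: "\<exists>b. (a, b) \<in> R" if "R \<in> ?X S" for R
  proof -
    have "card (fst ` R) = card A" "fst ` R \<subseteq> A"
      using that assms(3) by (auto simp: non_taking_iff_inj_on card_image)
    then have "fst ` R = A" using assms(1) card_subset_eq by blast
    with a(1) show ?thesis by force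
  qed
  have "?X S = (\<Union>b\<in>B - snd ` S. ?X (insert (a, b) S))"
  proof (intro equalityI subsetI)
    fix R assume R: "R \<in> ?X S"
    from row[OF R] obtain b where b: "(a, b) \<in> R" by blast
    have "b \<in> B" using R b by auto
    moreover have "b \<notin> snd ` S"
      using R b a(2) by (force simp: non_taking_def)
    ultimately show "R \<in> (\<Union>b\<in>B - snd ` S. ?X (insert (a, b) S))" using R b by auto
  qed auto
  then have "card (?X S) = card (\<Union>b\<in>B - snd ` S. ?X (insert (a, b) S))" by simp
  also have "\<dots> = (\<Sum>b\<in>B - snd ` S. card (?X (insert (a, b) S)))"
  proof (rule card_UN_disjoint)
    show "\<forall>b\<in>B - snd ` S. \<forall>b'\<in>B - snd ` S. b \<noteq> b' \<longrightarrow>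
        ?X (insert (a, b) S) \<inter> ?X (insert (a, b') S) = {}"
      by (force simp: non_taking_def)
  qed (use assms finX in auto)
  also have "\<dots> = (\<Sum>b\<in>B - snd ` S. fact n)"
  proof (rule sum.cong)
    fix b assume b: "b \<in> B - snd ` S"
    have ab: "(a, b) \<notin> S" using a(2) by force
    have n: "n = d - card (insert (a, b) S)"
      using ab finS Suc.hyps(2) by simp
    have "insert (a, b) S \<subseteq> A \<times> B" using b a Suc.prems(1) by auto
    moreover have "non_taking (insert (a, b) S)"
      using Suc.prems(2) a(2) b unfolding non_taking_def by force
    ultimately have "card (?X (insert (a, b) S)) = fact (d - card (insert (a, b) S))"
      by (rule Suc.hyps(1)[OF n])
    then show "card (?X (insert (a, b) S)) = fact n" by (simp only: n[symmetric])
  qed simp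
  also have "\<dots> = fact (Suc n)" using cB by simp
  finally show ?case using Suc.hyps(2) by simp
qed


section \<open>Isomorphism invariance\<close>

lemma dipath_arcs_map: "dipath_arcs (map f vs) = map_prod f f ` dipath_arcs vs"
  by (auto simp: dipath_arcs_def map_tl[symmetric] zip_map_map)

lemma dicycle_arcs_map: "dicycle_arcs (map f vs) = map_prod f f ` dicycle_arcs vs"
  by (auto simp: dicycle_arcs_def rotate1_map zip_map_map)

lemma incident_arcs_image:
  assumes "inj_on f V" "S \<subseteq> V \<times> V" "W \<subseteq> V"
  shows "incident_arcs (map_prod f f ` S) (f ` W) = map_prod f f ` incident_arcs S W"
proof -
  have "f v \<in> f ` W \<longleftrightarrow> v \<in> W" if "v \<in> V" for v
    using inj_on_image_mem_iff[OF assms(1) that assms(3)] .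
  then have "fst (map_prod f f e) \<in> f ` W \<or> snd (map_prod f f e) \<in> f ` W \<longleftrightarrow> fst e \<in> W \<or> snd e \<in> W"
    if "e \<in> S" for e
  proof -
    have "fst e \<in> V" "snd e \<in> V" using that assms(2) by auto
    then show ?thesis by (simp add: \<open>\<And>v. v \<in> V \<Longrightarrow> f v \<in> f ` W \<longleftrightarrow> v \<in> W\<close>)
  qed
  then have "{e \<in> S. fst (map_prod f f e) \<in> f ` W \<or> snd (map_prod f f e) \<in> f ` W} =
      {e \<in> S. fst e \<in> W \<or> snd e \<in> W}" by (intro Collect_cong) blast
  then show ?thesis
    unfolding incident_arcs_def Compr_image_eq by (rule arg_cong)
qed

lemma blocks_image_subset:
  assumes f: "bij_betw f (pverts D) (pverts E)" and S: "S \<subseteq> pverts D \<times> pverts D"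
  shows "(`) f ` path_blocks D S \<subseteq> path_blocks E (map_prod f f ` S)"
    and "(`) f ` cycle_blocks D S \<subseteq> cycle_blocks E (map_prod f f ` S)"
proof -
  have inj: "inj_on f (pverts D)" and im: "f ` pverts D = pverts E"
    using f by (auto simp: bij_betw_def)
  have *: "incident_arcs (map_prod f f ` S) (f ` set vs) = map_prod f f ` incident_arcs S (set vs)"
    "distinct vs \<Longrightarrow> distinct (map f vs)" "f ` set vs \<subseteq> pverts E" if "set vs \<subseteq> pverts D" for vs
    using that incident_arcs_image[OF inj S that] inj_on_subset[OF inj that] im[symmetric]
    by (auto simp: distinct_map)
  show "(`) f ` path_blocks D S \<subseteq> path_blocks E (map_prod f f ` S)"
  proof
    fix W assume "W \<in> (`) f ` path_blocks D S"
    then obtain vs where vs: "vs \<noteq> []" "distinct vs" "set vs \<subseteq> pverts D"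
      "incident_arcs S (set vs) = dipath_arcs vs" "W = f ` set vs"
      by (auto simp: path_blocks_def)
    then show "W \<in> path_blocks E (map_prod f f ` S)"
      unfolding path_blocks_def using *[OF vs(3)]
      by (auto simp: dipath_arcs_map intro!: exI[of _ "map f vs"])
  qed
  show "(`) f ` cycle_blocks D S \<subseteq> cycle_blocks E (map_prod f f ` S)"
  proof
    fix W assume "W \<in> (`) f ` cycle_blocks D S"
    then obtain vs where vs: "vs \<noteq> []" "distinct vs" "set vs \<subseteq> pverts D"
      "incident_arcs S (set vs) = dicycle_arcs vs" "W = f ` set vs"
      by (auto simp: cycle_blocks_def)
    then show "W \<in> cycle_blocks E (map_prod f f ` S)"
      unfolding cycle_blocks_def using *[OF vs(3)]
      by (auto simp: dicycle_arcs_map intro!: exI[of _ "map f vs"])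
  qed
qed

text \<open>The inclusions above, applied to the inverse isomorphism as well, become equalities.\<close>

lemma blocks_image:
  assumes f: "bij_betw f (pverts D) (pverts E)" and S: "S \<subseteq> pverts D \<times> pverts D"
  shows "path_blocks E (map_prod f f ` S) = (`) f ` path_blocks D S"
    and "cycle_blocks E (map_prod f f ` S) = (`) f ` cycle_blocks D S"
proof -
  define g where "g = inv_into (pverts D) f"
  have inj: "inj_on f (pverts D)" and im: "f ` pverts D = pverts E"
    using f by (auto simp: bij_betw_def)
  have g: "bij_betw g (pverts E) (pverts D)"
    unfolding g_def using f by (rule bij_betw_inv_into)
  have gf: "g (f x) = x" if "x \<in> pverts D" for x
    using that inj by (simp add: g_def)
  have fg: "f (g y) = y" if "y \<in> pverts E" for y
    using that im by (simp add: g_def f_inv_into_f)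
  have S': "map_prod f f ` S \<subseteq> pverts E \<times> pverts E" using S im by auto
  have gfS: "map_prod g g ` map_prod f f ` S = S"
  proof -
    have "map_prod g g (map_prod f f e) = e" if "e \<in> S" for e
      using that S gf by auto
    then show ?thesis by (simp add: image_image)
  qed
  have fgW: "f ` g ` W = W" if "W \<subseteq> pverts E" for W
    using that fg by (force simp: image_image)
  show "path_blocks E (map_prod f f ` S) = (`) f ` path_blocks D S"
  proof
    show "path_blocks E (map_prod f f ` S) \<subseteq> (`) f ` path_blocks D S"
    proof
      fix W assume W: "W \<in> path_blocks E (map_prod f f ` S)"
      then have "g ` W \<in> path_blocks D S"
        using blocks_image_subset(1)[OF g S'] gfS by auto
      moreover have "W \<subseteq> pverts E" using block_subset[of W E] W by blast
      ultimately show "W \<in> (`) f ` path_blocks D S" using fgW by (metis image_eqI)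
    qed
  qed (rule blocks_image_subset[OF assms])
  show "cycle_blocks E (map_prod f f ` S) = (`) f ` cycle_blocks D S"
  proof
    show "cycle_blocks E (map_prod f f ` S) \<subseteq> (`) f ` cycle_blocks D S"
    proof
      fix W assume W: "W \<in> cycle_blocks E (map_prod f f ` S)"
      then have "g ` W \<in> cycle_blocks D S"
        using blocks_image_subset(2)[OF g S'] gfS by auto
      moreover have "W \<subseteq> pverts E" using block_subset[of W E] W by blast
      ultimately show "W \<in> (`) f ` cycle_blocks D S" using fgW by (metis image_eqI)
    qed
  qed (rule blocks_image_subset[OF assms])
qed

lemma block_type_image:
  assumes "inj_on f V" "\<And>W. W \<in> P \<Longrightarrow> W \<subseteq> V"
  shows "block_type ((`) f ` P) = block_type P" "card ((`) f ` P) = card P"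
proof -
  have inj: "inj_on ((`) f) P"
    using assms by (metis (mono_tags) inj_on_image_eq_iff inj_onI)
  then show "card ((`) f ` P) = card P" by (rule card_image)
  have "block_type ((`) f ` P) = image_mset (card \<circ> (`) f) (mset_set P)"
    unfolding block_type_def by (simp add: image_mset_mset_set[OF inj, symmetric] multiset.map_comp)
  also have "\<dots> = block_type P" unfolding block_type_def
  proof (rule image_mset_cong)
    fix W assume "W \<in># mset_set P"
    then have "W \<subseteq> V" using assms(2) by (cases "finite P") auto
    then show "(card \<circ> (`) f) W = card W"
      using assms(1) by (simp add: card_image inj_on_subset)
  qed
  finally show "block_type ((`) f ` P) = block_type P" .
qed


section \<open>Every cover is isomorphic to a standard digraph\<close>

text \<open>
  This lets the blocks be listed in the order in which the parts of their type are listed, so that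
  the path (cycle) number \<open>i\<close> of the standard digraph has a block of the right size as its image.
\<close>

lemma ex_map_eq_of_image_mset_eq:
  assumes "image_mset f M = mset xs"
  shows "\<exists>ys. mset ys = M \<and> map f ys = xs"
  using assms
proof (induction xs arbitrary: M)
  case (Cons x xs)
  then obtain N a where N: "M = add_mset a N" "f a = x" "image_mset f N = mset xs"
    by (auto dest: msed_map_invR)
  from Cons.IH[OF N(3)] obtain ys where "mset ys = N" "map f ys = xs" by blast
  with N show ?case by (intro exI[of _ "a # ys"]) auto
qed simp

lemma ex_block_list:
  assumes "finite P"
  obtains Ws where "distinct Ws" "set Ws = P" "map card Ws = parts_list (block_type P)"
proof -
  have "image_mset card (mset_set P) = mset (parts_list (block_type P))"
    by (simp add: parts_list_def block_type_def)
  then obtain Ws where Ws: "mset Ws = mset_set P" "map card Ws = parts_list (block_type P)"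
    using ex_map_eq_of_image_mset_eq by blast
  have "set Ws = P"
    using Ws(1) assms by (metis finite_set_mset_mset_set set_mset_mset)
  moreover have "distinct Ws"
    using Ws(1) assms calculation by (metis distinct_count_atmost_1 count_mset_set(1) count_mset_set(3))
  ultimately show ?thesis using that Ws(2) by blast
qed

lemma path_cycle_digraph_arcs_subset:
  "parcs (path_cycle_digraph lam mu) \<subseteq> pverts (path_cycle_digraph lam mu) \<times> pverts (path_cycle_digraph lam mu)"
  by (auto simp: path_cycle_digraph_def Let_def)

text \<open>
  Traverse each block along its path or cycle. Vertex number \<open>k\<close> of component number \<open>i\<close> of the
  standard digraph is sent to vertex number \<open>k\<close> of the traversal of block number \<open>i\<close>. This is a
  bijection on vertices because the blocks partition the vertex set, and it carries arcs onto arcs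
  because every arc of \<open>C\<close> is incident with exactly one block.
\<close>

lemma cover_isomorphic_path_cycle_digraph:
  assumes fin: "finite (pverts D)" and C: "C \<subseteq> pverts D \<times> pverts D" "non_taking C"
  defines "E \<equiv> path_cycle_digraph (block_type (path_blocks D C)) (block_type (cycle_blocks D C))"
  shows "\<exists>f. bij_betw f (pverts E) (pverts D) \<and> map_prod f f ` parcs E = C"
proof -
  let ?P = "path_blocks D C" and ?C = "cycle_blocks D C"
  obtain Ps where Ps: "distinct Ps" "set Ps = ?P" "map card Ps = parts_list (block_type ?P)"
    using ex_block_list[OF finite_blocks(1)[OF fin]] .
  obtain Cs where Cs: "distinct Cs" "set Cs = ?C" "map card Cs = parts_list (block_type ?C)"
    using ex_block_list[OF finite_blocks(2)[OF fin]] .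
  have "\<forall>W\<in>?P. \<exists>vs. set vs = W \<and> distinct vs \<and> incident_arcs C W = dipath_arcs vs"
    by (auto simp: path_blocks_def)
  then obtain p where p: "\<And>W. W \<in> ?P \<Longrightarrow> set (p W) = W \<and> distinct (p W) \<and> incident_arcs C W = dipath_arcs (p W)"
    by metis
  have "\<forall>W\<in>?C. \<exists>vs. set vs = W \<and> distinct vs \<and> incident_arcs C W = dicycle_arcs vs"
    by (auto simp: cycle_blocks_def)
  then obtain c where c: "\<And>W. W \<in> ?C \<Longrightarrow> set (c W) = W \<and> distinct (c W) \<and> incident_arcs C W = dicycle_arcs (c W)"
    by metis
  define ps where "ps i = p (Ps ! i)" for i
  define cs where "cs i = c (Cs ! i)" for i
  have ps: "Ps ! i \<in> ?P" "set (ps i) = Ps ! i" "distinct (ps i)"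
    "incident_arcs C (Ps ! i) = dipath_arcs (ps i)" "parts_list (block_type ?P) ! i = length (ps i)"
    if "i < length Ps" for i
  proof -
    show i: "Ps ! i \<in> ?P" using nth_mem[OF that] Ps(2) by simp
    from p[OF i] show *: "set (ps i) = Ps ! i" "distinct (ps i)"
      "incident_arcs C (Ps ! i) = dipath_arcs (ps i)" by (auto simp: ps_def)
    show "parts_list (block_type ?P) ! i = length (ps i)"
      using that * Ps(3)[symmetric] by (metis distinct_card nth_map)
  qed
  have cs: "Cs ! i \<in> ?C" "set (cs i) = Cs ! i" "distinct (cs i)"
    "incident_arcs C (Cs ! i) = dicycle_arcs (cs i)" "parts_list (block_type ?C) ! i = length (cs i)"
    if "i < length Cs" for i
  proof -
    show i: "Cs ! i \<in> ?C" using nth_mem[OF that] Cs(2) by simp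
    from c[OF i] show *: "set (cs i) = Cs ! i" "distinct (cs i)"
      "incident_arcs C (Cs ! i) = dicycle_arcs (cs i)" by (auto simp: cs_def)
    show "parts_list (block_type ?C) ! i = length (cs i)"
      using that * Cs(3)[symmetric] by (metis distinct_card nth_map)
  qed
  have len: "length (parts_list (block_type ?P)) = length Ps"
    "length (parts_list (block_type ?C)) = length Cs"
    using Ps(3) Cs(3) by (metis length_map)+
  have verts: "pverts E = {Inl (i, k) | i k. i < length Ps \<and> k < length (ps i)} \<union>
                          {Inr (i, k) | i k. i < length Cs \<and> k < length (cs i)}"
    unfolding E_def path_cycle_digraph_def Let_def len using ps(5) cs(5) by auto
  have arcs: "parcs E = {(Inl (i, k), Inl (i, k + 1)) | i k. i < length Ps \<and> k + 1 < length (ps i)} \<union>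
      {(Inr (i, k), Inr (i, (k + 1) mod length (cs i))) | i k. i < length Cs \<and> k < length (cs i)}"
    unfolding E_def path_cycle_digraph_def Let_def len using ps(5) cs(5) by auto
  define f where "f = case_sum (\<lambda>(i, k). ps i ! k) (\<lambda>(i, k). cs i ! k)"
  \<comment> \<open>The block that contains the image of a vertex.\<close>
  define B where "B = case_sum (\<lambda>(i, k :: nat). Ps ! i) (\<lambda>(i, k :: nat). Cs ! i)"
  have B: "f u \<in> B u \<and> B u \<in> ?P \<union> ?C" if "u \<in> pverts E" for u
    using that ps(1) cs(1) ps(2)[symmetric] cs(2)[symmetric] by (auto simp: verts f_def B_def)
  have "inj_on f (pverts E)"
  proof (rule inj_onI)
    fix u v assume u: "u \<in> pverts E" and v: "v \<in> pverts E" and eq: "f u = f v"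
    have BB: "B u = B v"
      using blocks_eqI[of "B u" D C "B v" "f u"] B[OF u] B[OF v] eq by auto
    consider i k j l where "u = Inl (i, k)" "v = Inl (j, l)" "i < length Ps" "j < length Ps"
        "k < length (ps i)" "l < length (ps j)"
      | i k j l where "u = Inr (i, k)" "v = Inr (j, l)" "i < length Cs" "j < length Cs"
        "k < length (cs i)" "l < length (cs j)"
      | "B u \<in> ?P" "B v \<in> ?C" | "B u \<in> ?C" "B v \<in> ?P"
      using u v ps(1) cs(1) by (auto simp: verts B_def)
    then show "u = v"
    proof cases
      case 1
      then have "i = j" using BB Ps(1) by (simp add: B_def nth_eq_iff_index_eq)
      with 1 eq ps(3)[of i] show ?thesis by (simp add: f_def nth_eq_iff_index_eq)
    next
      case 2
      then have "i = j" using BB Cs(1) by (simp add: B_def nth_eq_iff_index_eq)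
      with 2 eq cs(3)[of i] show ?thesis by (simp add: f_def nth_eq_iff_index_eq)
    qed (use BB path_blocks_disjoint_cycle_blocks in fastforce)+
  qed
  moreover have "f ` pverts E = pverts D"
  proof
    show "f ` pverts E \<subseteq> pverts D"
      using B block_subset[of _ D C] by blast
    show "pverts D \<subseteq> f ` pverts E"
    proof
      fix v assume "v \<in> pverts D"
      from ex_block[OF fin C this] obtain W where W: "W \<in> ?P \<union> ?C" "v \<in> W" by blast
      then have "(\<exists>i<length Ps. W = Ps ! i) \<or> (\<exists>i<length Cs. W = Cs ! i)"
        unfolding Ps(2)[symmetric] Cs(2)[symmetric] by (auto simp: in_set_conv_nth)
      then consider i where "i < length Ps" "v \<in> set (ps i)" | i where "i < length Cs" "v \<in> set (cs i)"
        using W(2) ps(2) cs(2) by auto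
      then show "v \<in> f ` pverts E"
      proof cases
        case 1
        then obtain k where "k < length (ps i)" "v = ps i ! k" by (auto simp: in_set_conv_nth)
        with 1 show ?thesis by (intro image_eqI[of _ _ "Inl (i, k)"]) (auto simp: verts f_def)
      next
        case 2
        then obtain k where "k < length (cs i)" "v = cs i ! k" by (auto simp: in_set_conv_nth)
        with 2 show ?thesis by (intro image_eqI[of _ _ "Inr (i, k)"]) (auto simp: verts f_def)
      qed
    qed
  qed
  moreover have "map_prod f f ` parcs E = C"
  proof -
    have "map_prod f f ` parcs E =
        (\<Union>i<length Ps. dipath_arcs (ps i)) \<union> (\<Union>i<length Cs. dicycle_arcs (cs i))"
      unfolding arcs dipath_arcs_nth dicycle_arcs_nth image_Un
    proof (intro arg_cong2[where f = "(\<union>)"] equalityI subsetI)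
      fix e assume "e \<in> (\<Union>i<length Ps. {(ps i ! k, ps i ! (k + 1)) | k. k + 1 < length (ps i)})"
      then obtain i k where "i < length Ps" "k + 1 < length (ps i)" "e = (ps i ! k, ps i ! (k + 1))"
        by blast
      then show "e \<in> map_prod f f ` {(Inl (i, k), Inl (i, k + 1)) | i k. i < length Ps \<and> k + 1 < length (ps i)}"
        by (intro image_eqI[of _ _ "(Inl (i, k), Inl (i, k + 1))"]) (auto simp: f_def)
    next
      fix e assume "e \<in> (\<Union>i<length Cs. {(cs i ! k, cs i ! ((k + 1) mod length (cs i))) | k. k < length (cs i)})"
      then obtain i k where "i < length Cs" "k < length (cs i)" "e = (cs i ! k, cs i ! ((k + 1) mod length (cs i)))"
        by blast
      then show "e \<in> map_prod f f ` {(Inr (i, k), Inr (i, (k + 1) mod length (cs i))) | i k. i < length Cs \<and> k < length (cs i)}"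
        by (intro image_eqI[of _ _ "(Inr (i, k), Inr (i, (k + 1) mod length (cs i)))"]) (auto simp: f_def)
    qed (auto simp: f_def Bex_def, blast+)
    also have "\<dots> = (\<Union>i<length Ps. incident_arcs C (Ps ! i)) \<union> (\<Union>i<length Cs. incident_arcs C (Cs ! i))"
      using ps(4) cs(4) by simp
    also have "\<dots> = (\<Union>W\<in>?P \<union> ?C. incident_arcs C W)"
      unfolding Ps(2)[symmetric] Cs(2)[symmetric] by (fastforce simp: in_set_conv_nth)
    also have "\<dots> = C" by (rule Union_incident_arcs[OF fin C])
    finally show ?thesis .
  qed
  ultimately show ?thesis by (auto simp: bij_betw_def)
qed

definition cover_weight :: "'a pair_pre_digraph \<Rightarrow> ('a \<times> 'a) set \<Rightarrow> xy_series" where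
  "cover_weight D S =
     aug_monomial_x (block_type (path_blocks D S)) * power_sum_y (block_type (cycle_blocks D S))"

lemma cover_weight_image:
  assumes f: "bij_betw f (pverts E) (pverts D)" and S: "S \<subseteq> pverts E \<times> pverts E"
  shows "cover_weight D (map_prod f f ` S) = cover_weight E S"
    and "card (path_blocks D (map_prod f f ` S)) = card (path_blocks E S)"
proof -
  have inj: "inj_on f (pverts E)" using f by (simp add: bij_betw_def)
  have sub: "\<And>W. W \<in> path_blocks E S \<Longrightarrow> W \<subseteq> pverts E" "\<And>W. W \<in> cycle_blocks E S \<Longrightarrow> W \<subseteq> pverts E"
    using block_subset[of _ E S] by blast+
  show "cover_weight D (map_prod f f ` S) = cover_weight E S"
    using block_type_image(1)[OF inj sub(1)] block_type_image(1)[OF inj sub(2)]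
    by (simp add: cover_weight_def blocks_image[OF f S])
  show "card (path_blocks D (map_prod f f ` S)) = card (path_blocks E S)"
    using block_type_image(2)[OF inj sub(1)] by (simp add: blocks_image[OF f S])
qed

text \<open>
  Every subset of a non-taking set of arcs is non-taking, so that the path-cycle covers of the
  standard digraph are all its arc subsets, and the isomorphism matches them with the subsets
  of \<open>C\<close>.
\<close>

lemma path_cycle_sym_tilde_cover:
  assumes fin: "finite (pverts D)" and C: "C \<subseteq> pverts D \<times> pverts D" "non_taking C"
  shows "path_cycle_sym_tilde (block_type (path_blocks D C)) (block_type (cycle_blocks D C)) =
    (\<Sum>S\<in>Pow C. mconst (1 / fact (card (path_blocks D S))) * cover_weight D S)"
proof -
  define E where "E = path_cycle_digraph (block_type (path_blocks D C)) (block_type (cycle_blocks D C))"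
  obtain f where f: "bij_betw f (pverts E) (pverts D)" and fC: "map_prod f f ` parcs E = C"
    using cover_isomorphic_path_cycle_digraph[OF assms] unfolding E_def by blast
  have arcsE: "parcs E \<subseteq> pverts E \<times> pverts E"
    unfolding E_def by (rule path_cycle_digraph_arcs_subset)
  have injE: "inj_on (map_prod f f) (pverts E \<times> pverts E)"
    using f by (intro map_prod_inj_on) (auto simp: bij_betw_def)
  have inj: "inj_on (map_prod f f) (parcs E)" using injE arcsE by (rule inj_on_subset)
  have "non_taking (parcs E)"
    unfolding non_taking_def
  proof (intro ballI impI)
    fix r s assume rs: "r \<in> parcs E" "s \<in> parcs E" "r \<noteq> s"
    then have "map_prod f f r \<noteq> map_prod f f s" "map_prod f f r \<in> C" "map_prod f f s \<in> C"
      using inj fC by (auto dest: inj_onD)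
    then have "fst (map_prod f f r) \<noteq> fst (map_prod f f s)" "snd (map_prod f f r) \<noteq> snd (map_prod f f s)"
      using C(2) unfolding non_taking_def by blast+
    then show "fst r \<noteq> fst s \<and> snd r \<noteq> snd s" by auto
  qed
  then have covers: "path_cycle_covers E = Pow (parcs E)"
    by (auto simp: path_cycle_covers_def intro: non_taking_mono)
  have bij: "bij_betw ((`) (map_prod f f)) (Pow (parcs E)) (Pow C)"
    using inj fC by (intro bij_betw_Pow) (simp add: bij_betw_def)
  have "(\<Sum>S\<in>Pow C. mconst (1 / fact (card (path_blocks D S))) * cover_weight D S) =
      (\<Sum>S\<in>Pow (parcs E). mconst (1 / fact (card (path_blocks D (map_prod f f ` S)))) *
         cover_weight D (map_prod f f ` S))"
    by (rule sum.reindex_bij_betw[OF bij, symmetric])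
  also have "\<dots> = (\<Sum>S\<in>Pow (parcs E). mconst (1 / fact (card (path_blocks E S))) * cover_weight E S)"
  proof (rule sum.cong)
    fix S assume "S \<in> Pow (parcs E)"
    then have "S \<subseteq> pverts E \<times> pverts E" using arcsE by auto
    from cover_weight_image[OF f this]
    show "mconst (1 / fact (card (path_blocks D (map_prod f f ` S)))) * cover_weight D (map_prod f f ` S) =
        mconst (1 / fact (card (path_blocks E S))) * cover_weight E S" by simp
  qed simp
  also have "\<dots> = path_cycle_sym_tilde (block_type (path_blocks D C)) (block_type (cycle_blocks D C))"
    by (simp add: path_cycle_sym_tilde_def Let_def E_def[symmetric] covers cover_weight_def)
  finally show ?thesis by simp
qed


section \<open>The expansion\<close>

lemma mconst_add: "mconst (a + b :: 'a :: comm_ring_1) = mconst a + mconst b"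
  by transfer auto

lemma mconst_0: "mconst (0 :: 'a :: comm_ring_1) = 0"
  by transfer auto

lemma mconst_1: "mconst (1 :: 'a :: comm_ring_1) = 1"
  by transfer auto

lemma of_nat_mult_mconst: "of_nat n * mconst (c :: 'a :: comm_ring_1) = mconst (of_nat n * c)"
  by (induction n) (simp_all add: distrib_right mconst_add mconst_0)

lemma fact_mult_mconst_inverse: "of_nat (fact n) * mconst (1 / fact n :: 'a :: field_char_0) = 1"
  unfolding of_nat_mult_mconst by (simp add: mconst_1)

lemma integer_partition_block_type:
  assumes "\<And>W. W \<in> P \<Longrightarrow> finite W \<and> W \<noteq> {}"
  shows "integer_partition (block_type P)"
  using assms by (cases "finite P") (auto simp: integer_partition_def block_type_def)

lemma integer_partition_blocks:
  assumes "finite (pverts D)"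
  shows "integer_partition (block_type (path_blocks D S))" "integer_partition (block_type (cycle_blocks D S))"
proof -
  have "finite W \<and> W \<noteq> {}" if "W \<in> path_blocks D S \<union> cycle_blocks D S" for W
    using block_nonempty[OF that] finite_subset[OF block_subset[OF that] assms] by simp
  then show "integer_partition (block_type (path_blocks D S))" "integer_partition (block_type (cycle_blocks D S))"
    by (auto intro!: integer_partition_block_type)
qed

theorem theorem2:
  fixes D :: "nat pair_pre_digraph" and d :: nat
  assumes "pair_fin_digraph D" and "pverts D = {1..d}"
  shows "path_cycle_sym D =
    (\<Sum>(lam, mu) \<in> {(lam, mu). integer_partition lam \<and> integer_partition mu \<and>
                           rook_number d D lam mu \<noteq> 0}.
       of_nat (rook_number d D lam mu) * path_cycle_sym_tilde lam mu)"
proof -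
  interpret pair_fin_digraph D by fact
  let ?V = "{1..d}"
  have finV: "finite (pverts D)" using assms(2) by simp
  have arcs: "parcs D \<subseteq> pverts D \<times> pverts D"
    using in_arcsD1 in_arcsD2 by auto
  define Rs where "Rs = {R. R \<subseteq> ?V \<times> ?V \<and> non_taking R \<and> card R = d}"
  define t where "t R = (block_type (path_blocks D (R \<inter> parcs D)), block_type (cycle_blocks D (R \<inter> parcs D)))"
    for R
  define w where "w S = mconst (1 / fact (card (path_blocks D S))) * cover_weight D S" for S
  have finR: "finite Rs"
    unfolding Rs_def by (rule finite_subset[of _ "Pow (?V \<times> ?V)"]) auto
  have finC: "finite (path_cycle_covers D)"
    unfolding path_cycle_covers_def by (rule finite_subset[of _ "Pow (parcs D)"]) auto
  have placements: "rook_placements d D lam mu = {R \<in> Rs. t R = (lam, mu)}" for lam mu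
    by (auto simp: rook_placements_def Rs_def t_def)
  \<comment> \<open>Blocks are nonempty and finite, so that only pairs of partitions occur as types.\<close>
  have support: "{(lam, mu). integer_partition lam \<and> integer_partition mu \<and> rook_number d D lam mu \<noteq> 0} = t ` Rs"
    using finR integer_partition_blocks[OF finV]
    by (force simp: rook_number_def placements card_eq_0_iff t_def)
  have "path_cycle_sym D = (\<Sum>S\<in>path_cycle_covers D. cover_weight D S)"
    by (simp add: path_cycle_sym_def cover_weight_def)
  \<comment> \<open>The denominator in \<open>w S\<close> cancels the number of completions of \<open>S\<close>.\<close>
  also have "\<dots> = (\<Sum>S\<in>path_cycle_covers D. \<Sum>R\<in>{R \<in> Rs. S \<subseteq> R}. w S)"
  proof (rule sum.cong)
    fix S assume "S \<in> path_cycle_covers D"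
    then have S: "S \<subseteq> pverts D \<times> pverts D" "non_taking S"
      using arcs by (auto simp: path_cycle_covers_def)
    have "{R \<in> Rs. S \<subseteq> R} = {R. R \<subseteq> ?V \<times> ?V \<and> non_taking R \<and> card R = d \<and> S \<subseteq> R}"
      by (auto simp: Rs_def)
    then have "card {R \<in> Rs. S \<subseteq> R} = fact (d - card S)"
      using card_rook_completions[of ?V ?V d S] S assms(2) by simp
    also have "d - card S = card (path_blocks D S)"
      using card_path_blocks[OF finV S] assms(2) by simp
    finally show "cover_weight D S = (\<Sum>R\<in>{R \<in> Rs. S \<subseteq> R}. w S)"
      using fact_mult_mconst_inverse[where 'a = rat and 'b = "nat + nat"]
      by (simp add: w_def mult.assoc[symmetric] del: of_nat_fact)
  qed simp
  also have "\<dots> = (\<Sum>R\<in>Rs. \<Sum>S\<in>{S \<in> path_cycle_covers D. S \<subseteq> R}. w S)"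
    by (rule sum.swap_restrict[OF finC finR])
  also have "\<dots> = (\<Sum>R\<in>Rs. case_prod path_cycle_sym_tilde (t R))"
  proof (rule sum.cong)
    fix R assume R: "R \<in> Rs"
    then have C: "R \<inter> parcs D \<subseteq> pverts D \<times> pverts D" "non_taking (R \<inter> parcs D)"
      using arcs by (auto simp: Rs_def intro: non_taking_mono)
    have "{S \<in> path_cycle_covers D. S \<subseteq> R} = Pow (R \<inter> parcs D)"
      using R by (auto simp: path_cycle_covers_def Rs_def intro: non_taking_mono)
    then show "(\<Sum>S\<in>{S \<in> path_cycle_covers D. S \<subseteq> R}. w S) = case_prod path_cycle_sym_tilde (t R)"
      using path_cycle_sym_tilde_cover[OF finV C] by (simp add: w_def t_def)
  qed simp
  also have "\<dots> = (\<Sum>z\<in>t ` Rs. \<Sum>R\<in>{R \<in> Rs. t R = z}. case_prod path_cycle_sym_tilde (t R))"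
    by (rule sum.image_gen[OF finR])
  also have "\<dots> = (\<Sum>(lam, mu)\<in>t ` Rs. of_nat (rook_number d D lam mu) * path_cycle_sym_tilde lam mu)"
    by (rule sum.cong) (auto simp: rook_number_def placements)
  finally show ?thesis by (simp only: support)
qed

end
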